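(* There exists a $3$-dimensional polytope $P\subset\mathbb R^3$ with $10$ vertices such that, for $\mathbf c=(1,0,0)$, the sequence $(N_\ell)_\ell$ of the numbers of $\mathbf c$-monotone paths of length $\ell$ on $P$ is not unimodal.
   Context: For a polytope $P\subset\mathbb R^d$ and $\mathbf c\in\mathbb R^d$ such that $\langle\cdot,\mathbf c\rangle$ attains its minimum and maximum over $P$ at unique vertices $v_{\min}$, $v_{\max}$, let $G_{P,\mathbf c}$ be the directed graph on the vertices of $P$ with an arc $u\to v$ whenever $[u,v]$ is an edge of $P$ with $\langle u,\mathbf c\rangle<\langle v,\mathbf c\rangle$. A $\mathbf c$-monotone path is a directed path in $G_{P,\mathbf c}$ from $v_{\min}$ to $v_{\max}$; its length is its number of edges, and $N_\ell$ is the number of such paths of length $\ell$. A finite sequence $(a_1,\dots,a_r)$ is unimodal if there is $k$ with $a_i\le a_{i+1}$ for $i<k$ and $a_i\ge a_{i+1}$ for $i\ge k$. *)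

theory Defs
  imports "HOL-Analysis.Analysis" "Graph_Theory.Pair_Digraph"
begin

definition vertices :: "(real ^ 'd) set \<Rightarrow> (real ^ 'd) set" where
  "vertices P = {v. v extreme_point_of P}"

definition unique_min_vertex :: "(real ^ 'd) set \<Rightarrow> real ^ 'd \<Rightarrow> real ^ 'd \<Rightarrow> bool" where
  "unique_min_vertex P c v \<longleftrightarrow> v \<in> vertices P \<and> (\<forall>x\<in>P. x \<noteq> v \<longrightarrow> v \<bullet> c < x \<bullet> c)"

definition unique_max_vertex :: "(real ^ 'd) set \<Rightarrow> real ^ 'd \<Rightarrow> real ^ 'd \<Rightarrow> bool" where
  "unique_max_vertex P c v \<longleftrightarrow> v \<in> vertices P \<and> (\<forall>x\<in>P. x \<noteq> v \<longrightarrow> x \<bullet> c < v \<bullet> c)"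

definition monotone_digraph ::
    "(real ^ 'd) set \<Rightarrow> real ^ 'd \<Rightarrow> (real ^ 'd) pair_pre_digraph" where
  "monotone_digraph P c =
     \<lparr> pverts = vertices P,
       parcs = {(u, v). u \<in> vertices P \<and> v \<in> vertices P \<and>
                        closed_segment u v edge_of P \<and> u \<bullet> c < v \<bullet> c} \<rparr>"

text \<open>A path is represented by its list of arcs, so the length of the list is the number of edges.\<close>

definition monotone_path ::
    "(real ^ 'd) set \<Rightarrow> real ^ 'd \<Rightarrow> ((real ^ 'd) \<times> (real ^ 'd)) list \<Rightarrow> bool" where
  "monotone_path P c p \<longleftrightarrow>
     (\<exists>vmin vmax. unique_min_vertex P c vmin \<and> unique_max_vertex P c vmax \<and>
        pre_digraph.apath (with_proj (monotone_digraph P c)) vmin p vmax)"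

definition num_monotone_paths :: "(real ^ 'd) set \<Rightarrow> real ^ 'd \<Rightarrow> nat \<Rightarrow> nat" where
  "num_monotone_paths P c l = card {p. monotone_path P c p \<and> length p = l}"

text \<open>A path visits each vertex at most once, so every possible length is smaller than the number
  of vertices; the sequence below therefore lists all the path numbers that can be nonzero.\<close>

definition monotone_path_sequence :: "(real ^ 'd) set \<Rightarrow> real ^ 'd \<Rightarrow> nat list" where
  "monotone_path_sequence P c = map (num_monotone_paths P c) [0..<card (vertices P)]"

definition unimodal :: "'a::linorder list \<Rightarrow> bool" where
  "unimodal a \<longleftrightarrow>
     (\<exists>k. \<forall>i. Suc i < length a \<longrightarrow>
        (i < k \<longrightarrow> a ! i \<le> a ! Suc i) \<and> (k \<le> i \<longrightarrow> a ! Suc i \<le> a ! i))"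

end

theory Submission
  imports Defs
begin

text \<open>
  If the minimal and the maximal vertex are joined by an edge but have no common neighbour, then
  \<open>N\<^sub>1 = 1\<close> and \<open>N\<^sub>2 = 0\<close>, so a single monotone path of length at least 3 destroys unimodality.
  This happens for the hipped roof over the octagon with vertices \<open>(\<plusminus>1, 2, \<plusminus>2)\<close> and \<open>(\<plusminus>2, 2, \<plusminus>1)\<close>
  whose ridge joins \<open>(-3, 0, 0)\<close> to \<open>(3, 0, 0)\<close>. These ten points have norm 3, so each of them is a
  vertex. A point of the octagon and its mirror image in the plane \<open>x = 0\<close> form a trapezoid with the
  ridge; the diagonals of the trapezoid cross, so they are not edges, and the point is adjacent to at
  most one end of the ridge. The detour from end to end via \<open>(-1, 2, 2)\<close> and \<open>(1, 2, 2)\<close> has length 3.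
\<close>

section \<open>Faces of convex hulls\<close>

lemma convex_hull_subset_halfspace_le:
  assumes "\<And>x. x \<in> S \<Longrightarrow> a \<bullet> x \<le> b"
  shows "convex hull S \<subseteq> {x. a \<bullet> x \<le> b}"
  using assms by (intro hull_minimal) (auto simp: convex_halfspace_le)

lemma convex_hull_Int_supporting_hyperplane:
  fixes S :: "'a::euclidean_space set"
  assumes "compact S" and le: "\<And>x. x \<in> S \<Longrightarrow> a \<bullet> x \<le> b"
  shows "(convex hull S \<inter> {x. a \<bullet> x = b}) face_of convex hull S"
    and "convex hull S \<inter> {x. a \<bullet> x = b} = convex hull (S \<inter> {x. a \<bullet> x = b})"
proof -
  let ?F = "convex hull S \<inter> {x. a \<bullet> x = b}"
  show face: "?F face_of convex hull S"
    using convex_hull_subset_halfspace_le[OF le]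
    by (intro face_of_Int_supporting_hyperplane_le) auto
  then obtain S' where "S' \<subseteq> S" and F: "?F = convex hull S'"
    using face_of_convex_hull_subset[OF \<open>compact S\<close>] by metis
  then have "S' \<subseteq> S \<inter> {x. a \<bullet> x = b}"
    using hull_subset[of S' convex] by blast
  then have "?F \<subseteq> convex hull (S \<inter> {x. a \<bullet> x = b})"
    unfolding F by (rule hull_mono)
  moreover have "convex hull (S \<inter> {x. a \<bullet> x = b}) \<subseteq> ?F"
    by (intro hull_minimal) (auto simp: hull_inc convex_Int convex_hyperplane)
  ultimately show "?F = convex hull (S \<inter> {x. a \<bullet> x = b})" ..
qed

lemma unique_max_vertex_convex_hullI:
  assumes "compact S" "v \<in> S" and less: "\<And>w. w \<in> S \<Longrightarrow> w \<noteq> v \<Longrightarrow> w \<bullet> c < v \<bullet> c"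
  shows "unique_max_vertex (convex hull S) c v"
proof -
  have le: "c \<bullet> w \<le> c \<bullet> v" if "w \<in> S" for w
    using less[OF that] by (cases "w = v") (auto simp: inner_commute)
  have "S \<inter> {x. c \<bullet> x = c \<bullet> v} = {v}"
    using \<open>v \<in> S\<close> less by (force simp: inner_commute)
  then have face: "{v} face_of convex hull S"
    and eq: "convex hull S \<inter> {x. c \<bullet> x = c \<bullet> v} = {v}"
    using convex_hull_Int_supporting_hyperplane[OF \<open>compact S\<close> le] by simp_all
  have "convex hull S \<subseteq> {x. c \<bullet> x \<le> c \<bullet> v}"
    using le by (rule convex_hull_subset_halfspace_le)
  with eq have "\<forall>x \<in> convex hull S. x \<noteq> v \<longrightarrow> x \<bullet> c < v \<bullet> c"
    by (fastforce simp: inner_commute)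
  with face show ?thesis
    by (simp add: unique_max_vertex_def vertices_def face_of_singleton)
qed

lemma unique_min_vertex_iff: "unique_min_vertex P c v \<longleftrightarrow> unique_max_vertex P (- c) v"
  by (simp add: unique_max_vertex_def unique_min_vertex_def)

lemma closed_segment_edge_of_convex_hullI:
  fixes S :: "'a::euclidean_space set"
  assumes "compact S" "u \<in> S" "v \<in> S" "u \<noteq> v" and eq: "a \<bullet> u = a \<bullet> v"
    and less: "\<And>w. w \<in> S \<Longrightarrow> w \<noteq> u \<Longrightarrow> w \<noteq> v \<Longrightarrow> a \<bullet> w < a \<bullet> v"
  shows "closed_segment u v edge_of convex hull S"
proof -
  have "S \<inter> {x. a \<bullet> x = a \<bullet> v} = {u, v}"
    using assms by force
  moreover have "a \<bullet> w \<le> a \<bullet> v" if "w \<in> S" for w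
    using less[OF that] eq by fastforce
  ultimately have "convex hull {u, v} face_of convex hull S"
    using convex_hull_Int_supporting_hyperplane[OF \<open>compact S\<close>, of a "a \<bullet> v"] by simp
  moreover have "aff_dim (convex hull {u, v}) = 1"
    using \<open>u \<noteq> v\<close> by (simp only: aff_dim_convex_hull aff_dim_2 if_False)
  ultimately show ?thesis
    by (simp add: edge_of_def segment_convex_hull)
qed

lemma extreme_points_of_convex_hull_subset_sphere:
  fixes S :: "'a::euclidean_space set"
  assumes "S \<subseteq> sphere a r"
  shows "{x. x extreme_point_of convex hull S} = S"
proof (intro equalityI extreme_points_of_convex_hull subsetI CollectI)
  fix x assume "x \<in> S"
  have ball: "convex hull S \<subseteq> cball a r"
    using assms by (intro hull_minimal) auto
  have "x \<notin> open_segment y z" if "y \<in> convex hull S" "z \<in> convex hull S" for y z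
    using dist_decreases_open_segment[of x y z a] that ball \<open>x \<in> S\<close> assms
    by (fastforce simp: subset_iff)
  then show "x extreme_point_of convex hull S"
    using \<open>x \<in> S\<close> by (simp add: extreme_point_of_def hull_inc)
qed

lemma trapezoid_diagonals_meet:
  fixes a b c d :: "'a::real_vector"
  assumes "0 < k" and parallel: "b - a = k *\<^sub>R (c - d)" and "a \<noteq> c" "b \<noteq> d"
  shows "open_segment a c \<inter> open_segment b d \<noteq> {}"
proof -
  define t where "t = k / (1 + k)"
  have t: "0 < t" "t < 1" "t = (1 - t) * k"
    using \<open>0 < k\<close> by (auto simp: t_def field_simps)
  have "(1 - t) *\<^sub>R b + t *\<^sub>R d = (1 - t) *\<^sub>R (a + (b - a)) + t *\<^sub>R d"
    by simp
  also have "\<dots> = (1 - t) *\<^sub>R a + ((1 - t) * k) *\<^sub>R (c - d) + t *\<^sub>R d"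
    unfolding parallel by (simp add: scaleR_right_distrib)
  also have "\<dots> = (1 - t) *\<^sub>R a + t *\<^sub>R c"
    unfolding t(3)[symmetric] by (simp add: scaleR_right_diff_distrib)
  finally show ?thesis
    using t(1,2) \<open>a \<noteq> c\<close> \<open>b \<noteq> d\<close> by (force simp: in_segment)
qed

lemma closed_segment_refl_not_edge_of: "\<not> closed_segment v v edge_of P"
  by (simp add: edge_of_def)

lemma trapezoid_diagonal_not_edge_of:
  fixes a b c d :: "'a::euclidean_space"
  assumes "b extreme_point_of P" "d \<in> P" "b \<noteq> a" "b \<noteq> c" "b \<noteq> d"
    and "0 < k" "b - a = k *\<^sub>R (c - d)"
  shows "\<not> closed_segment a c edge_of P"
proof
  assume edge: "closed_segment a c edge_of P"
  then have face: "closed_segment a c face_of P"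
    by (simp add: edge_of_def)
  have "a \<noteq> c"
    using edge closed_segment_refl_not_edge_of by blast
  then obtain p where "p \<in> open_segment a c" "p \<in> open_segment b d"
    using trapezoid_diagonals_meet[of k b a c d] assms by blast
  then have "b \<in> closed_segment a c"
    using face assms(1,2) open_closed_segment
    unfolding face_of_def extreme_point_of_def by blast
  then have "b extreme_point_of closed_segment a c"
    using assms(1) face by (simp add: extreme_point_of_face)
  then show False
    using assms(3,4) by (simp add: extreme_point_of_segment)
qed

lemma closed_segment_edge_of_imp_vertices:
  assumes "closed_segment u v edge_of P"
  shows "u \<in> vertices P" "v \<in> vertices P"
  using assms extreme_point_of_face[of "closed_segment u v" P]
  by (auto simp: edge_of_def vertices_def extreme_point_of_segment)

section \<open>Monotone paths\<close>

lemma verts_monotone_digraph [simp]: "pverts (monotone_digraph P c) = vertices P"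
  by (simp add: monotone_digraph_def)

lemma arc_monotone_digraph_iff:
  "(u, v) \<in> parcs (monotone_digraph P c) \<longleftrightarrow> closed_segment u v edge_of P \<and> u \<bullet> c < v \<bullet> c"
  by (auto simp: monotone_digraph_def dest: closed_segment_edge_of_imp_vertices)

lemma pair_fin_digraph_monotone_digraph:
  assumes "finite (vertices P)"
  shows "pair_fin_digraph (monotone_digraph P c)"
proof
  show "finite (parcs (monotone_digraph P c))"
    by (rule finite_subset[of _ "vertices P \<times> vertices P"])
      (auto simp: monotone_digraph_def assms)
qed (auto simp: monotone_digraph_def assms)

lemma unique_min_vertex_unique:
  "unique_min_vertex P c u \<Longrightarrow> unique_min_vertex P c v \<Longrightarrow> u = v"
  by (force simp: unique_min_vertex_def vertices_def extreme_point_of_def)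

lemma unique_max_vertex_unique:
  "unique_max_vertex P c u \<Longrightarrow> unique_max_vertex P c v \<Longrightarrow> u = v"
  by (force simp: unique_max_vertex_def vertices_def extreme_point_of_def)

lemma monotone_path_iff_apath:
  assumes "unique_min_vertex P c u" "unique_max_vertex P c v"
  shows "monotone_path P c p \<longleftrightarrow> pre_digraph.apath (with_proj (monotone_digraph P c)) u p v"
  using assms unfolding monotone_path_def
  by (blast dest: unique_min_vertex_unique unique_max_vertex_unique)

lemma length_monotone_path_less:
  assumes "finite (vertices P)" "monotone_path P c p"
  shows "length p < card (vertices P)"
proof -
  interpret pair_fin_digraph "monotone_digraph P c"
    using assms(1) by (rule pair_fin_digraph_monotone_digraph)
  show ?thesis
    using assms(2) length_apath_less by (auto simp: monotone_path_def)
qed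

lemma num_monotone_paths_pos_iff:
  assumes "finite (vertices P)"
  shows "0 < num_monotone_paths P c l \<longleftrightarrow> (\<exists>p. monotone_path P c p \<and> length p = l)"
proof -
  interpret pair_fin_digraph "monotone_digraph P c"
    using assms by (rule pair_fin_digraph_monotone_digraph)
  have "{p. monotone_path P c p} \<subseteq> (fst \<circ> snd) ` {(u, p, v). apath u p v}"
    by (force simp: monotone_path_def)
  then have "finite {p. monotone_path P c p}"
    using apaths_finite_triple by (rule finite_surj[rotated])
  then show ?thesis
    by (auto simp: num_monotone_paths_def card_gt_0_iff)
qed

lemma unimodal_iff_sorted:
  "unimodal a \<longleftrightarrow> (\<exists>k. sorted (take (Suc k) a) \<and> sorted_wrt (\<ge>) (drop k a))"
proof -
  have up: "sorted (take (Suc k) a) \<longleftrightarrow> (\<forall>i. Suc i < length a \<longrightarrow> i < k \<longrightarrow> a ! i \<le> a ! Suc i)" for k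
    by (auto simp: sorted_iff_nth_Suc)
  have down: "sorted_wrt (\<ge>) (drop k a)
      \<longleftrightarrow> (\<forall>i. Suc i < length a \<longrightarrow> k \<le> i \<longrightarrow> a ! Suc i \<le> a ! i)" for k
  proof -
    have "sorted_wrt (\<ge>) (drop k a)
        \<longleftrightarrow> (\<forall>j. Suc (k + j) < length a \<longrightarrow> a ! Suc (k + j) \<le> a ! (k + j))"
      by (subst sorted_wrt_iff_nth_Suc_transp) (auto intro!: transpI)
    then show ?thesis
      by (metis le_add1 le_iff_add)
  qed
  show ?thesis
    unfolding unimodal_def up down by blast
qed

lemma not_unimodal_if_valley:
  assumes "i < j" "j < k" "k < length a" "a ! j < a ! i" "a ! j < a ! k"
  shows "\<not> unimodal a"
proof
  assume "unimodal a"
  then obtain m where up: "sorted (take (Suc m) a)" and down: "sorted_wrt (\<ge>) (drop m a)"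
    by (auto simp: unimodal_iff_sorted)
  consider (ascent) "j \<le> m" | (descent) "m \<le> j"
    by linarith
  then show False
  proof cases
    case ascent
    with assms have "a ! i \<le> a ! j"
      using sorted_nth_mono[OF up, of i j] by simp
    with assms show False by simp
  next
    case descent
    with assms have "a ! k \<le> a ! j"
      using sorted_wrt_nth_less[OF down, of "j - m" "k - m"] by simp
    with assms show False by simp
  qed
qed

lemma not_unimodal_monotone_path_sequenceI:
  assumes fin: "finite (vertices P)"
    and min: "unique_min_vertex P c u" and max: "unique_max_vertex P c v"
    and edge: "closed_segment u v edge_of P"
    and no_common_neighbour:
      "\<And>w. closed_segment u w edge_of P \<Longrightarrow> \<not> closed_segment w v edge_of P"
    and path: "monotone_path P c p" "2 < length p"
  shows "\<not> unimodal (monotone_path_sequence P c)"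
proof -
  interpret pair_fin_digraph "monotone_digraph P c"
    using fin by (rule pair_fin_digraph_monotone_digraph)
  note monotone_path_iff = monotone_path_iff_apath[OF min max]
  have "u \<noteq> v"
    using edge closed_segment_refl_not_edge_of by blast
  then have "u \<bullet> c < v \<bullet> c" "u \<in> vertices P" "v \<in> vertices P"
    using min max by (auto simp: unique_min_vertex_def unique_max_vertex_def vertices_def
        extreme_point_of_def)
  then have "monotone_path P c [(u, v)]"
    using edge \<open>u \<noteq> v\<close>
    by (simp add: monotone_path_iff apath_Cons_iff apath_Nil_iff arc_monotone_digraph_iff)
  then have pos_1: "0 < num_monotone_paths P c 1"
    unfolding num_monotone_paths_pos_iff[OF fin] by force
  have "\<not> monotone_path P c q" if "length q = 2" for q
    using that no_common_neighbour
    by (auto simp: numeral_2_eq_2 length_Suc_conv monotone_path_iff apath_Cons_iff apath_Nil_iff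
        arc_monotone_digraph_iff)
  then have zero_2: "num_monotone_paths P c 2 = 0"
    using num_monotone_paths_pos_iff[OF fin, of c 2] by blast
  have pos_length: "0 < num_monotone_paths P c (length p)"
    using path num_monotone_paths_pos_iff[OF fin] by blast
  have "length p < card (vertices P)"
    using fin path(1) by (rule length_monotone_path_less)
  then show ?thesis
    using pos_1 zero_2 pos_length path(2)
    by (intro not_unimodal_if_valley[of 1 2 "length p"])
      (simp_all add: monotone_path_sequence_def numeral_2_eq_2)
qed

section \<open>An octagonal roof\<close>

abbreviation ridge_start :: "real ^ 3" where
  "ridge_start \<equiv> vector [- 3, 0, 0]"

abbreviation ridge_end :: "real ^ 3" where
  "ridge_end \<equiv> vector [3, 0, 0]"

definition roof_vertices :: "(real ^ 3) set" where
  "roof_vertices = {ridge_start, ridge_end,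
     vector [- 2, 2, 1], vector [- 1, 2, 2], vector [1, 2, 2], vector [2, 2, 1],
     vector [- 2, 2, - 1], vector [- 1, 2, - 2], vector [1, 2, - 2], vector [2, 2, - 1]}"

definition roof :: "(real ^ 3) set" where
  "roof = convex hull roof_vertices"

lemma vector3_eq_iff:
  "(vector [x, y, z] :: 'a::zero ^ 3) = vector [x', y', z'] \<longleftrightarrow> x = x' \<and> y = y' \<and> z = z'"
  by (simp add: vec_eq_iff forall_3)

lemma inner_vector3:
  "(vector [x, y, z] :: real ^ 3) \<bullet> vector [x', y', z'] = x * x' + y * y' + z * z'"
  by (simp add: inner_vec_def sum_3)

lemma finite_roof_vertices: "finite roof_vertices"
  by (simp add: roof_vertices_def)

lemma compact_roof_vertices: "compact roof_vertices"
  using finite_roof_vertices by (rule finite_imp_compact)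

lemma card_roof_vertices: "card roof_vertices = 10"
  by (simp add: roof_vertices_def vector3_eq_iff)

lemma roof_vertices_subset_sphere: "roof_vertices \<subseteq> sphere 0 3"
  by (simp add: roof_vertices_def norm_eq_sqrt_inner inner_vector3)

lemma vertices_roof: "vertices roof = roof_vertices"
  unfolding vertices_def roof_def
  using roof_vertices_subset_sphere by (rule extreme_points_of_convex_hull_subset_sphere)

lemma finite_vertices_roof: "finite (vertices roof)"
  by (simp add: vertices_roof finite_roof_vertices)

lemma aff_dim_roof: "aff_dim roof = 3"
proof -
  have "midpoint ridge_start ridge_end \<in> affine hull roof_vertices"
    by (rule subsetD[OF convex_hull_subset_affine_hull], rule midpoints_in_convex_hull)
      (simp_all add: roof_vertices_def hull_inc)
  moreover have "midpoint ridge_start ridge_end = 0"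
    by (simp add: midpoint_def vec_eq_iff forall_3)
  ultimately have zero: "0 \<in> affine hull roof_vertices"
    by simp
  have "v \<in> span roof_vertices" for v :: "real ^ 3"
  proof -
    have "v = (v $ 1 / 3 - v $ 2 / 6) *\<^sub>R ridge_end
        + ((v $ 2 + v $ 3) / 4) *\<^sub>R vector [1, 2, 2] + ((v $ 2 - v $ 3) / 4) *\<^sub>R vector [1, 2, - 2]"
      by (simp add: vec_eq_iff forall_3 field_simps)
    also have "\<dots> \<in> span roof_vertices"
      by (intro span_add span_scale span_base) (simp_all add: roof_vertices_def)
    finally show ?thesis .
  qed
  then have "span roof_vertices = UNIV"
    by blast
  then have "dim roof_vertices = 3"
    using dim_span[of roof_vertices] by simp
  then show ?thesis
    using zero by (simp add: roof_def aff_dim_convex_hull aff_dim_zero)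
qed

lemma edge_of_roofI:
  assumes "u \<in> roof_vertices" "v \<in> roof_vertices" "u \<noteq> v" "a \<bullet> u = a \<bullet> v"
    and "\<forall>w \<in> roof_vertices. w = u \<or> w = v \<or> a \<bullet> w < a \<bullet> v"
  shows "closed_segment u v edge_of roof"
  unfolding roof_def
  by (rule closed_segment_edge_of_convex_hullI[OF compact_roof_vertices assms(1-4)])
    (use assms(5) in blast)

lemma ridge_edge_of_roof: "closed_segment ridge_start ridge_end edge_of roof"
  by (rule edge_of_roofI[where a = "vector [0, - 1, 0]"])
    (simp_all add: roof_vertices_def inner_vector3 vector3_eq_iff)

lemma detour_edges_of_roof:
  "closed_segment ridge_start (vector [- 1, 2, 2]) edge_of roof"
  "closed_segment (vector [- 1, 2, 2]) (vector [1, 2, 2]) edge_of roof"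
  "closed_segment (vector [1, 2, 2]) ridge_end edge_of roof"
proof -
  show "closed_segment ridge_start (vector [- 1, 2, 2]) edge_of roof"
    by (rule edge_of_roofI[where a = "vector [- 1, - 1, 2]"])
      (simp_all add: roof_vertices_def inner_vector3 vector3_eq_iff)
  show "closed_segment (vector [- 1, 2, 2]) (vector [1, 2, 2]) edge_of roof"
    by (rule edge_of_roofI[where a = "vector [0, 0, 1]"])
      (simp_all add: roof_vertices_def inner_vector3 vector3_eq_iff)
  show "closed_segment (vector [1, 2, 2]) ridge_end edge_of roof"
    by (rule edge_of_roofI[where a = "vector [1, - 1, 2]"])
      (simp_all add: roof_vertices_def inner_vector3 vector3_eq_iff)
qed

lemma roof_vertices_reflect:
  "w \<in> roof_vertices \<Longrightarrow> vector [- (w $ 1), w $ 2, w $ 3] \<in> roof_vertices"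
  unfolding roof_vertices_def by (elim insertE emptyE) (simp_all add: vector3_eq_iff)

lemma roof_vertices_nth_1_nonzero: "w \<in> roof_vertices \<Longrightarrow> w $ 1 \<noteq> 0"
  by (auto simp: roof_vertices_def)

lemma ridge_ends_no_common_neighbour:
  assumes edge: "closed_segment ridge_start w edge_of roof"
  shows "\<not> closed_segment w ridge_end edge_of roof"
proof (cases "w = ridge_start \<or> w = ridge_end")
  case True
  then show ?thesis
    using edge closed_segment_refl_not_edge_of by metis
next
  case False
  define w' :: "real ^ 3" where "w' = vector [- (w $ 1), w $ 2, w $ 3]"
  have w: "w \<in> roof_vertices"
    using closed_segment_edge_of_imp_vertices(2)[OF edge] by (simp add: vertices_roof)
  then have w': "w' \<in> roof" "w' \<noteq> ridge_start" "w' \<noteq> ridge_end"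
    using roof_vertices_reflect False by (auto simp: w'_def roof_def hull_inc vec_eq_iff forall_3)
  have ridge: "ridge_start extreme_point_of roof" "ridge_end extreme_point_of roof"
    using vertices_roof by (auto simp: vertices_def roof_vertices_def)
  have parallel: "ridge_end - ridge_start = (3 / w $ 1) *\<^sub>R (w - w')"
    "ridge_start - ridge_end = (- 3 / w $ 1) *\<^sub>R (w - w')"
    using roof_vertices_nth_1_nonzero[OF w] by (simp_all add: w'_def vec_eq_iff forall_3)
  consider (near_end) "0 < 3 / w $ 1" | (near_start) "0 < - 3 / w $ 1"
    using roof_vertices_nth_1_nonzero[OF w] by (cases "0 < w $ 1") (simp_all add: field_simps)
  then show ?thesis
  proof cases
    case near_end
    have "\<not> closed_segment ridge_start w edge_of roof"
      by (rule trapezoid_diagonal_not_edge_of[OF ridge(2) w'(1) _ _ _ near_end parallel(1)])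
        (use False w' in \<open>auto simp: vector3_eq_iff\<close>)
    with edge show ?thesis by contradiction
  next
    case near_start
    have "\<not> closed_segment ridge_end w edge_of roof"
      by (rule trapezoid_diagonal_not_edge_of[OF ridge(1) w'(1) _ _ _ near_start parallel(2)])
        (use False w' in \<open>auto simp: vector3_eq_iff\<close>)
    then show ?thesis
      by (simp add: closed_segment_commute)
  qed
qed

lemma unique_min_vertex_roof: "unique_min_vertex roof (vector [1, 0, 0]) ridge_start"
  unfolding unique_min_vertex_iff roof_def
  by (rule unique_max_vertex_convex_hullI[OF compact_roof_vertices])
    (auto simp: roof_vertices_def inner_vector3)

lemma unique_max_vertex_roof: "unique_max_vertex roof (vector [1, 0, 0]) ridge_end"
  unfolding roof_def
  by (rule unique_max_vertex_convex_hullI[OF compact_roof_vertices])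
    (auto simp: roof_vertices_def inner_vector3)

lemma monotone_path_roof_detour:
  "monotone_path roof (vector [1, 0, 0])
     [(ridge_start, vector [- 1, 2, 2]), (vector [- 1, 2, 2], vector [1, 2, 2]),
      (vector [1, 2, 2], ridge_end)]"
proof -
  interpret pair_fin_digraph "monotone_digraph roof (vector [1, 0, 0])"
    using finite_vertices_roof by (rule pair_fin_digraph_monotone_digraph)
  show ?thesis
    unfolding monotone_path_iff_apath[OF unique_min_vertex_roof unique_max_vertex_roof]
    using detour_edges_of_roof
    by (simp add: apath_Cons_iff apath_Nil_iff arc_monotone_digraph_iff inner_vector3
        vector3_eq_iff vertices_roof roof_vertices_def)
qed

theorem theorem4p7:
  fixes c :: "real ^ 3"
  assumes "c = vector [1, 0, 0]"
  shows "\<exists>P :: (real ^ 3) set.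
           polytope P \<and> aff_dim P = 3 \<and> card (vertices P) = 10 \<and>
           (\<exists>v. unique_min_vertex P c v) \<and> (\<exists>v. unique_max_vertex P c v) \<and>
           \<not> unimodal (monotone_path_sequence P c)"
proof (intro exI conjI)
  show "polytope roof"
    by (simp add: roof_def finite_roof_vertices polytope_convex_hull)
  show "aff_dim roof = 3"
    by (rule aff_dim_roof)
  show "card (vertices roof) = 10"
    by (simp add: vertices_roof card_roof_vertices)
  show min: "unique_min_vertex roof c ridge_start"
    unfolding assms by (rule unique_min_vertex_roof)
  show max: "unique_max_vertex roof c ridge_end"
    unfolding assms by (rule unique_max_vertex_roof)
  show "\<not> unimodal (monotone_path_sequence roof c)"
    using ridge_ends_no_common_neighbour monotone_path_roof_detour
    by (intro not_unimodal_monotone_path_sequenceI[OF finite_vertices_roof min max ridge_edge_of_roof])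
      (auto simp: assms)
qed

end
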